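(* Let $n\ge 1$. If $A\in M_n(\mathbb{H})$, then $$w_{\mathbb{H}}(A)\le\frac12\Big(\|A\|+\|A^2\|^{1/2}\Big).$$
   Context: $\mathbb{H}$ denotes the real quaternions and $M_n(\mathbb{H})$ the $n\times n$ quaternionic matrices, acting on column vectors in the right quaternionic Hilbert space $\mathbb{H}^n$ from the left. The inner product is $\langle (p_l),(q_l)\rangle_{\mathbb{H}}=\sum_l\overline{p_l}\,q_l$, with norm $\|X\|=\langle X,X\rangle_{\mathbb{H}}^{1/2}$; $S_{\mathbb{H}^n}$ is the unit sphere. $\|A\|=\sup\{\|AX\|:X\in S_{\mathbb{H}^n}\}$ is the operator norm. The quaternionic numerical range is $W_{\mathbb{H}}(A)=\{\langle X,AX\rangle_{\mathbb{H}}:X\in S_{\mathbb{H}^n}\}$ and the quaternionic numerical radius is $w_{\mathbb{H}}(A)=\sup\{|q|:q\in W_{\mathbb{H}}(A)\}$. *)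

theory Defs
  imports "HOL-Analysis.Analysis"
begin

section \<open>The real quaternions\<close>

datatype quat = Quat (qRe: real) (qI: real) (qJ: real) (qK: real)

lemma quat_eq_iff:
  "p = q \<longleftrightarrow> qRe p = qRe q \<and> qI p = qI q \<and> qJ p = qJ q \<and> qK p = qK q"
  by (cases p; cases q) simp

instantiation quat :: ring_1
begin

definition "0 = Quat 0 0 0 0"
definition "1 = Quat 1 0 0 0"
definition "p + q = Quat (qRe p + qRe q) (qI p + qI q) (qJ p + qJ q) (qK p + qK q)"
definition "- p = Quat (- qRe p) (- qI p) (- qJ p) (- qK p)"
definition "p - q = Quat (qRe p - qRe q) (qI p - qI q) (qJ p - qJ q) (qK p - qK q)"

(* Hamilton's relations i^2 = j^2 = k^2 = ijk = -1, extended bilinearly. *)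
definition "p * q = Quat
  (qRe p * qRe q - qI p * qI q - qJ p * qJ q - qK p * qK q)
  (qRe p * qI q + qI p * qRe q + qJ p * qK q - qK p * qJ q)
  (qRe p * qJ q - qI p * qK q + qJ p * qRe q + qK p * qI q)
  (qRe p * qK q + qI p * qJ q - qJ p * qI q + qK p * qRe q)"

instance
  by standard
    (simp_all add: zero_quat_def one_quat_def plus_quat_def uminus_quat_def minus_quat_def
      times_quat_def algebra_simps)

end

lemma quat_zero_sel [simp]: "qRe 0 = 0" "qI 0 = 0" "qJ 0 = 0" "qK 0 = 0"
  by (simp_all add: zero_quat_def)

lemma quat_one_sel [simp]: "qRe 1 = 1" "qI 1 = 0" "qJ 1 = 0" "qK 1 = 0"
  by (simp_all add: one_quat_def)

lemma quat_add_sel [simp]: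
  "qRe (p + q) = qRe p + qRe q" "qI (p + q) = qI p + qI q"
  "qJ (p + q) = qJ p + qJ q" "qK (p + q) = qK p + qK q"
  by (simp_all add: plus_quat_def)

lemma quat_uminus_sel [simp]:
  "qRe (- p) = - qRe p" "qI (- p) = - qI p" "qJ (- p) = - qJ p" "qK (- p) = - qK p"
  by (simp_all add: uminus_quat_def)

lemma quat_diff_sel [simp]:
  "qRe (p - q) = qRe p - qRe q" "qI (p - q) = qI p - qI q"
  "qJ (p - q) = qJ p - qJ q" "qK (p - q) = qK p - qK q"
  by (simp_all add: minus_quat_def)

lemma quat_mult_sel [simp]:
  "qRe (p * q) = qRe p * qRe q - qI p * qI q - qJ p * qJ q - qK p * qK q"
  "qI (p * q) = qRe p * qI q + qI p * qRe q + qJ p * qK q - qK p * qJ q"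
  "qJ (p * q) = qRe p * qJ q - qI p * qK q + qJ p * qRe q + qK p * qI q"
  "qK (p * q) = qRe p * qK q + qI p * qJ q - qJ p * qI q + qK p * qRe q"
  by (simp_all add: times_quat_def)

instantiation quat :: real_vector
begin

definition "r *\<^sub>R q = Quat (r * qRe q) (r * qI q) (r * qJ q) (r * qK q)"

instance
  by standard (simp_all add: scaleR_quat_def quat_eq_iff algebra_simps)

end

lemma quat_scaleR_sel [simp]:
  "qRe (r *\<^sub>R q) = r * qRe q" "qI (r *\<^sub>R q) = r * qI q"
  "qJ (r *\<^sub>R q) = r * qJ q" "qK (r *\<^sub>R q) = r * qK q"
  by (simp_all add: scaleR_quat_def)

instantiation quat :: real_inner
begin

definition inner_quat :: "quat \<Rightarrow> quat \<Rightarrow> real" where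
  "inner_quat p q = qRe p * qRe q + qI p * qI q + qJ p * qJ q + qK p * qK q"
definition norm_quat :: "quat \<Rightarrow> real" where
  "norm_quat q = sqrt ((qRe q)\<^sup>2 + (qI q)\<^sup>2 + (qJ q)\<^sup>2 + (qK q)\<^sup>2)"
definition sgn_quat :: "quat \<Rightarrow> quat" where "sgn_quat q = q /\<^sub>R norm q"
definition dist_quat :: "quat \<Rightarrow> quat \<Rightarrow> real" where "dist_quat p q = norm (p - q)"
definition [code del]:
  "(uniformity :: (quat \<times> quat) filter) = (INF e\<in>{0 <..}. principal {(p, q). dist p q < e})"
definition [code del]:
  "open (U :: quat set) \<longleftrightarrow> (\<forall>x\<in>U. \<forall>\<^sub>F (x', y) in uniformity. x' = x \<longrightarrow> y \<in> U)"

instance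
proof
  fix r :: real and p q t :: quat
  show "inner p q = inner q p" "inner (p + q) t = inner p t + inner q t"
    "inner (r *\<^sub>R p) q = r * inner p q"
    by (simp_all add: inner_quat_def algebra_simps)
  show "0 \<le> inner p p"
    by (simp add: inner_quat_def)
  have *: "inner p p = (qRe p)\<^sup>2 + (qI p)\<^sup>2 + (qJ p)\<^sup>2 + (qK p)\<^sup>2"
    by (simp add: inner_quat_def power2_eq_square)
  show "inner p p = 0 \<longleftrightarrow> p = 0"
    unfolding * by (simp add: quat_eq_iff add_nonneg_eq_0_iff)
  show "norm p = sqrt (inner p p)"
    unfolding * norm_quat_def ..
qed (simp_all only: sgn_quat_def dist_quat_def uniformity_quat_def open_quat_def)

end

definition qcnj :: "quat \<Rightarrow> quat" where
  "qcnj q = Quat (qRe q) (- qI q) (- qJ q) (- qK q)"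

lemma qcnj_sel [simp]:
  "qRe (qcnj q) = qRe q" "qI (qcnj q) = - qI q" "qJ (qcnj q) = - qJ q" "qK (qcnj q) = - qK q"
  by (simp_all add: qcnj_def)

lemma norm_quat_square: "(norm (q::quat))\<^sup>2 = (qRe q)\<^sup>2 + (qI q)\<^sup>2 + (qJ q)\<^sup>2 + (qK q)\<^sup>2"
  by (simp add: norm_quat_def)

lemma norm_qcnj [simp]: "norm (qcnj q) = norm q"
  by (simp add: norm_quat_def)

instantiation quat :: real_normed_div_algebra
begin

definition inverse_quat :: "quat \<Rightarrow> quat" where "inverse_quat q = qcnj q /\<^sub>R (norm q)\<^sup>2"
definition divide_quat :: "quat \<Rightarrow> quat \<Rightarrow> quat" where "divide_quat p q = p * inverse q"

instance
proof
  show scaleR_left: "r *\<^sub>R p * q = r *\<^sub>R (p * q)" and "p * r *\<^sub>R q = r *\<^sub>R (p * q)"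
    for r and p q :: quat
    by (simp_all add: quat_eq_iff algebra_simps)
  have scaleR_right: "p * r *\<^sub>R q = r *\<^sub>R (p * q)" for r and p q :: quat
    by (simp add: quat_eq_iff algebra_simps)
  have *: "p * qcnj p = (norm p)\<^sup>2 *\<^sub>R 1" "qcnj p * p = (norm p)\<^sup>2 *\<^sub>R 1" for p
    by (simp_all add: quat_eq_iff norm_quat_square[unfolded power2_eq_square] power2_eq_square)
  show "inverse p * p = 1" "p * inverse p = 1" if "p \<noteq> 0" for p :: quat
    using that by (simp_all add: inverse_quat_def scaleR_left scaleR_right *)
next
  fix p q :: quat
  show "p div q = p * inverse q" by (fact divide_quat_def)
  show "inverse (0::quat) = 0" by (simp add: inverse_quat_def)
  have "(norm (p * q))\<^sup>2 = (norm p * norm q)\<^sup>2"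
    unfolding power_mult_distrib norm_quat_square by (simp add: power2_eq_square algebra_simps)
  then show "norm (p * q) = norm p * norm q"
    by (simp add: power2_eq_iff_nonneg)
qed

end


section \<open>Quaternionic numerical range\<close>

definition hinner :: "quat ^ 'n::finite \<Rightarrow> quat ^ 'n \<Rightarrow> quat" where
  "hinner X Y = (\<Sum>l\<in>UNIV. qcnj (X $ l) * Y $ l)"

(* The library norm on quat ^ 'n is the one induced by hinner. *)
lemma hinner_self: "hinner X X = of_real ((norm X)\<^sup>2)"
proof -
  have "qcnj q * q = of_real ((norm q)\<^sup>2)" for q
    by (simp add: of_real_def quat_eq_iff norm_quat_square[unfolded power2_eq_square] power2_eq_square)
  then show ?thesis
    by (simp add: hinner_def norm_vec_def L2_set_def sum_nonneg)
qed

definition opnorm :: "quat ^ 'n ^ 'n::finite \<Rightarrow> real" where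
  "opnorm A = (SUP X\<in>sphere 0 1. norm (A *v X))"

definition W_H :: "quat ^ 'n ^ 'n::finite \<Rightarrow> quat set" where
  "W_H A = {hinner X (A *v X) | X. X \<in> sphere 0 1}"

definition w_H :: "quat ^ 'n ^ 'n::finite \<Rightarrow> real" where
  "w_H A = (SUP q\<in>W_H A. norm q)"

(* The suprema above are taken in the reals, so they are meaningful only because
   the sets are nonempty and bounded. *)
lemma sphere_quat_vec_nonempty: "(sphere 0 1 :: (quat ^ 'n::finite) set) \<noteq> {}"
proof -
  have "(axis undefined 1 :: quat ^ 'n) \<in> sphere 0 1"
    by (simp add: norm_vec_def L2_set_def axis_def if_distrib[of norm] if_distrib[of "\<lambda>x. x\<^sup>2"] cong: if_cong)
  then show ?thesis by blast
qed

lemma W_H_nonempty: "W_H A \<noteq> {}"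
  unfolding W_H_def using sphere_quat_vec_nonempty by blast

lemma norm_matrix_vector_le:
  fixes A :: "quat ^ 'n ^ 'n::finite"
  assumes "X \<in> sphere 0 1"
  shows "norm (A *v X) \<le> (\<Sum>i\<in>UNIV. \<Sum>j\<in>UNIV. norm (A $ i $ j))"
proof -
  have X: "norm (X $ j) \<le> 1" for j
    using Finite_Cartesian_Product.norm_nth_le[of X j] assms by simp
  have "norm (A *v X) \<le> (\<Sum>i\<in>UNIV. norm ((A *v X) $ i))"
    unfolding norm_vec_def by (rule L2_set_le_sum) simp
  also have "\<dots> \<le> (\<Sum>i\<in>UNIV. \<Sum>j\<in>UNIV. norm (A $ i $ j * X $ j))"
    by (intro sum_mono) (simp add: matrix_vector_mult_def norm_sum)
  also have "\<dots> \<le> (\<Sum>i\<in>UNIV. \<Sum>j\<in>UNIV. norm (A $ i $ j))"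
    by (intro sum_mono) (simp add: norm_mult mult_left_le X)
  finally show ?thesis .
qed

lemma bdd_above_opnorm: "bdd_above ((\<lambda>X. norm (A *v X)) ` sphere 0 1)"
  for A :: "quat ^ 'n ^ 'n::finite"
  using norm_matrix_vector_le by (intro bdd_aboveI2)

lemma bdd_above_W_H: "bdd_above (norm ` W_H A)"
  for A :: "quat ^ 'n ^ 'n::finite"
proof -
  define C where "C = (\<Sum>i\<in>UNIV. \<Sum>j\<in>UNIV. norm (A $ i $ j))"
  have "norm (hinner X (A *v X)) \<le> of_nat CARD('n) * C" if X: "X \<in> sphere 0 1" for X
  proof -
    have "norm (qcnj (X $ l) * (A *v X) $ l) \<le> C" for l
    proof -
      have "norm (X $ l) \<le> 1"
        using Finite_Cartesian_Product.norm_nth_le[of X l] X by simp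
      moreover have "norm ((A *v X) $ l) \<le> C"
        using Finite_Cartesian_Product.norm_nth_le[of "A *v X" l] norm_matrix_vector_le[OF X, of A]
        by (simp add: C_def)
      ultimately have "norm (X $ l) * norm ((A *v X) $ l) \<le> 1 * C"
        by (intro mult_mono) auto
      then show ?thesis by (simp add: norm_mult)
    qed
    then show ?thesis
      unfolding hinner_def by (intro sum_norm_bound)
  qed
  then show ?thesis
    by (intro bdd_aboveI2[where M = "of_nat CARD('n) * C"]) (auto simp: W_H_def)
qed

end

theory Submission
  imports Defs
begin

text \<open>
  If \<open>q = \<langle>X, A X\<rangle>\<close> and the unit quaternion \<open>u\<close> rotates \<open>q\<close> to \<open>\<bar>q\<bar>\<close>, then
  \<open>\<bar>q\<bar>\<close> is the real inner product of \<open>X\<close> with \<open>T X\<close>, where \<open>T Y = (A Y) u\<close>. Right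
  multiplication by \<open>u\<close> commutes with \<open>A\<close>, so \<open>\<parallel>T\<parallel> = \<parallel>A\<parallel>\<close> and \<open>\<parallel>T\<^sup>2\<parallel> = \<parallel>A\<^sup>2\<parallel>\<close>, and
  the claim becomes Kittaneh's inequality for a real operator \<open>T\<close>.
  With \<open>a = |T|\<close> and \<open>b = |T\<^sup>*|\<close>, both read off a singular value decomposition, the mixed
  Schwarz inequality gives \<open>2 \<langle>x, T x\<rangle> \<le> \<langle>x, (a + b) x\<rangle>\<close>. If \<open>x\<close> is a unit eigenvector of \<open>a + b\<close>
  for its largest eigenvalue \<open>\<mu>\<close>, then \<open>b x = (\<mu> - a) x\<close> and \<open>a x = (\<mu> - b) x\<close> give
  \<open>a b x = (\<mu> - a) (\<mu> - b) x\<close>, whence \<open>(\<mu> - \<parallel>T\<parallel>)\<^sup>2 \<le> \<parallel>a b\<parallel> = \<parallel>T\<^sup>2\<parallel>\<close>.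
\<close>

section \<open>Singular value decomposition\<close>

text \<open>First-order condition: near \<open>t = 0\<close> a nonzero linear term would dominate
  and change sign.\<close>

lemma nonneg_quadratic_imp_linear_coeff_zero:
  fixes c d :: real
  assumes "\<And>t. 0 \<le> 2 * t * d + t\<^sup>2 * c"
  shows "d = 0"
proof (rule ccontr)
  assume "d \<noteq> 0"
  define k where "k = \<bar>c\<bar> + 1"
  have k: "k > 0" "c < k" by (auto simp: k_def)
  \<comment> \<open>\<open>- d / k\<close> minimises \<open>2 * t * d + t\<^sup>2 * k\<close>;
    replacing \<open>c\<close> by the larger, positive \<open>k\<close> covers every sign of
    \<open>c\<close>.\<close>
  have "0 \<le> (2 * (- d / k) * d + (- d / k)\<^sup>2 * c) * k\<^sup>2"
    using assms[of "- d / k"] by (rule mult_nonneg_nonneg) simp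
  also have "\<dots> = d\<^sup>2 * (c - 2 * k)"
    using k by (simp add: field_simps power2_eq_square)
  also have "\<dots> < 0"
    using k \<open>d \<noteq> 0\<close> by (intro mult_pos_neg) auto
  finally show False by simp
qed

text \<open>Rayleigh quotient on the compact unit sphere of \<open>V\<close>, whose first variation
  vanishes at a maximum. Two maps are allowed so that \<open>f = g = T\<close> gives singular
  vectors and \<open>g\<close> the identity gives eigenvectors.\<close>

lemma quadratic_form_maximizer:
  fixes f g :: "'a::euclidean_space \<Rightarrow> 'a"
  assumes f: "linear f" and g: "linear g"
    and sym: "\<And>x y. f x \<bullet> g y = f y \<bullet> g x"
    and V: "subspace V" "V \<noteq> {0}"
  obtains u where "u \<in> V" "norm u = 1"
    "\<And>y. y \<in> V \<Longrightarrow> f y \<bullet> g y \<le> (f u \<bullet> g u) * (norm y)\<^sup>2"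
    "\<And>h. h \<in> V \<Longrightarrow> f u \<bullet> g h = (f u \<bullet> g u) * (u \<bullet> h)"
proof -
  have "0 \<in> V" using V by (simp add: subspace_0)
  then obtain z where z: "z \<in> V" "z \<noteq> 0" using V by blast
  have "sgn z \<in> sphere 0 1 \<inter> V"
    using z V by (simp add: norm_sgn sgn_div_norm subspace_mul)
  then have ne: "sphere 0 1 \<inter> V \<noteq> {}" by blast
  have "compact (sphere 0 1 \<inter> V)"
    using V by (simp add: compact_Int_closed closed_subspace)
  moreover have "continuous_on (sphere 0 1 \<inter> V) (\<lambda>y. f y \<bullet> g y)"
    using f g by (intro continuous_on_inner linear_continuous_on) (auto simp: linear_conv_bounded_linear)
  ultimately obtain u where u: "u \<in> V" "norm u = 1"
    and max: "\<And>y. y \<in> V \<Longrightarrow> norm y = 1 \<Longrightarrow> f y \<bullet> g y \<le> f u \<bullet> g u"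
    using continuous_attains_sup[OF _ ne, of "\<lambda>y. f y \<bullet> g y"] by auto
  define \<mu> where "\<mu> = f u \<bullet> g u"
  have le: "f y \<bullet> g y \<le> \<mu> * (norm y)\<^sup>2" if "y \<in> V" for y
  proof (cases "y = 0")
    case True
    then show ?thesis using f by (simp add: linear_0)
  next
    case False
    have "f (sgn y) \<bullet> g (sgn y) \<le> \<mu>"
      using max[of "sgn y"] that False V by (simp add: \<mu>_def norm_sgn sgn_div_norm subspace_mul)
    moreover have "f (sgn y) \<bullet> g (sgn y) = (f y \<bullet> g y) / (norm y)\<^sup>2"
      using f g by (simp add: sgn_div_norm linear_scale power2_eq_square divide_simps)
    ultimately show ?thesis
      using False by (simp add: divide_simps)
  qed
  have "f u \<bullet> g h = \<mu> * (u \<bullet> h)" if h: "h \<in> V" for h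
  proof -
    \<comment> \<open>By \<open>le\<close> the gap
      \<open>\<mu> * (norm y)\<^sup>2 - f y \<bullet> g y\<close> is nonnegative on
      \<open>V\<close>, and it is zero at \<open>u\<close>; along \<open>u + t *\<^sub>R h\<close>
      it is a quadratic in \<open>t\<close> without constant term.\<close>
    have "\<mu> * (u \<bullet> h) - f u \<bullet> g h = 0"
    proof (rule nonneg_quadratic_imp_linear_coeff_zero)
      fix t :: real
      have "u + t *\<^sub>R h \<in> V"
        using V u h by (simp add: subspace_add subspace_mul)
      then have *: "f (u + t *\<^sub>R h) \<bullet> g (u + t *\<^sub>R h) \<le> \<mu> * (norm (u + t *\<^sub>R h))\<^sup>2"
        by (rule le)
      have "f (u + t *\<^sub>R h) \<bullet> g (u + t *\<^sub>R h) = \<mu> + 2 * t * (f u \<bullet> g h) + t\<^sup>2 * (f h \<bullet> g h)"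
        using f g sym[of h u]
        by (simp add: linear_add linear_scale inner_simps \<mu>_def power2_eq_square algebra_simps)
      moreover have "(norm (u + t *\<^sub>R h))\<^sup>2 = 1 + 2 * t * (u \<bullet> h) + t\<^sup>2 * (norm h)\<^sup>2"
        unfolding power2_norm_eq_inner using u
        by (simp add: inner_simps inner_commute[of h u] power2_eq_square norm_eq_1 algebra_simps)
      ultimately show "0 \<le> 2 * t * (\<mu> * (u \<bullet> h) - f u \<bullet> g h) + t\<^sup>2 * (\<mu> * (norm h)\<^sup>2 - f h \<bullet> g h)"
        using * by (simp add: algebra_simps)
    qed
    then show ?thesis by simp
  qed
  with u le show ?thesis
    unfolding \<mu>_def by (rule that)
qed

text \<open>Split off a unit vector \<open>u\<close> that \<open>T\<close> stretches most.
  Criticality makes \<open>T u\<close> orthogonal to \<open>T h\<close> for all \<open>h\<close> in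
  \<open>V\<close> orthogonal to \<open>u\<close>, so induction applies to that complement.\<close>

lemma singular_value_basis_subspace:
  fixes T :: "'a::euclidean_space \<Rightarrow> 'a"
  assumes T: "linear T" and "subspace V"
  shows "\<exists>B. finite B \<and> span B = V \<and> pairwise orthogonal B \<and> (\<forall>u\<in>B. norm u = 1) \<and>
           pairwise (\<lambda>u v. orthogonal (T u) (T v)) B"
  using \<open>subspace V\<close>
proof (induction "dim V" arbitrary: V rule: less_induct)
  case less
  show ?case
  proof (cases "V = {0}")
    case True
    then show ?thesis by (intro exI[of _ "{}"]) auto
  next
    case False
    obtain u where u: "u \<in> V" "norm u = 1"
      and "\<And>y. y \<in> V \<Longrightarrow> T y \<bullet> T y \<le> (T u \<bullet> T u) * (norm y)\<^sup>2"
      and orth: "\<And>h. h \<in> V \<Longrightarrow> T u \<bullet> T h = (T u \<bullet> T u) * (u \<bullet> h)"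
      by (rule quadratic_form_maximizer[OF T T inner_commute less.prems False]) (rule that)
    define V' where "V' = {v \<in> V. u \<bullet> v = 0}"
    have V': "subspace V'"
      using less.prems by (auto simp: V'_def subspace_def inner_simps)
    have "u \<notin> V'" using u by (auto simp: V'_def norm_eq_1)
    then have "V' \<subset> V" using u(1) by (auto simp only: V'_def)
    then have "dim V' < dim V"
      using V' less.prems by (intro dim_psubset) (simp add: span_eq_iff[THEN iffD2])
    from less.hyps[OF this V'] obtain B where B: "finite B" "span B = V'" "pairwise orthogonal B"
      "\<forall>u\<in>B. norm u = 1" "pairwise (\<lambda>u v. orthogonal (T u) (T v)) B"
      by blast
    have BV: "B \<subseteq> V'" using B(2) span_superset by blast
    have "span (insert u B) = V"
    proof
      show "span (insert u B) \<subseteq> V"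
        using u BV less.prems by (intro span_minimal) (auto simp: V'_def)
      show "V \<subseteq> span (insert u B)"
      proof
        fix v assume "v \<in> V"
        then have "v - (u \<bullet> v) *\<^sub>R u \<in> span B"
          using u less.prems
          by (simp add: B(2) V'_def subspace_diff subspace_mul inner_simps norm_eq_1)
        then show "v \<in> span (insert u B)"
          using span_breakdown_eq by blast
      qed
    qed
    moreover have "pairwise orthogonal (insert u B)"
      using B(3) BV by (auto simp: pairwise_insert V'_def orthogonal_def inner_commute)
    moreover have "T u \<bullet> T v = 0" if "v \<in> B" for v
      using BV that by (subst orth) (auto simp: V'_def)
    then have "pairwise (\<lambda>u v. orthogonal (T u) (T v)) (insert u B)"
      using B(5) by (simp add: pairwise_insert orthogonal_def inner_commute)
    ultimately show ?thesis
      using B u by (intro exI[of _ "insert u B"]) auto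
  qed
qed

section \<open>Kittaneh's inequality for real operators\<close>

text \<open>Bessel's inequality by Cauchy-Schwarz for the projection \<open>p\<close> of
  \<open>y\<close>. The family is indexed and may repeat the zero vector, as
  \<open>sgn (T u)\<close> does on the kernel.\<close>

lemma bessel_sum_bound:
  fixes v :: "'i \<Rightarrow> 'a::real_inner"
  assumes "finite I" and orth: "pairwise (\<lambda>i j. orthogonal (v i) (v j)) I"
    and unit: "\<And>i. i \<in> I \<Longrightarrow> v i = 0 \<or> norm (v i) = 1"
  shows "(\<Sum>i\<in>I. (v i \<bullet> y)\<^sup>2) \<le> (norm y)\<^sup>2"
proof -
  define p where "p = (\<Sum>i\<in>I. (v i \<bullet> y) *\<^sub>R v i)"
  have "(norm p)\<^sup>2 = (\<Sum>i\<in>I. (norm ((v i \<bullet> y) *\<^sub>R v i))\<^sup>2)"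
    unfolding p_def using orth
    by (intro norm_sum_Pythagorean[OF \<open>finite I\<close>]) (auto simp: pairwise_def orthogonal_def)
  also have "\<dots> = (\<Sum>i\<in>I. (v i \<bullet> y)\<^sup>2)"
    using unit by (intro sum.cong) (force simp: power_mult_distrib)+
  finally have p: "(norm p)\<^sup>2 = (\<Sum>i\<in>I. (v i \<bullet> y)\<^sup>2)" .
  also have "\<dots> = p \<bullet> y"
    by (simp add: p_def inner_sum_left power2_eq_square)
  also have "\<dots> \<le> norm p * norm y"
    by (rule norm_cauchy_schwarz)
  finally have "norm p \<le> norm y"
    by (cases "norm p = 0") (auto simp: power2_eq_square)
  then show ?thesis
    using p power_mono[of "norm p" "norm y" 2] by simp
qed

lemma norm_sum_orthonormal:
  fixes B :: "'a::real_inner set"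
  assumes "finite B" "pairwise orthogonal B" "\<And>u. u \<in> B \<Longrightarrow> norm u = 1"
  shows "(norm (\<Sum>u\<in>B. c u *\<^sub>R u))\<^sup>2 = (\<Sum>u\<in>B. (c u)\<^sup>2)"
proof -
  have "(norm (\<Sum>u\<in>B. c u *\<^sub>R u))\<^sup>2 = (\<Sum>u\<in>B. (norm (c u *\<^sub>R u))\<^sup>2)"
    using assms by (intro norm_sum_Pythagorean) (auto simp: pairwise_def orthogonal_def)
  then show ?thesis using assms by (simp add: power_mult_distrib)
qed

lemma kittaneh_real:
  fixes T :: "'a::euclidean_space \<Rightarrow> 'a"
  assumes T: "linear T"
    and m: "\<And>y. norm (T y) \<le> m * norm y"
    and c: "\<And>y. norm (T (T y)) \<le> c * norm y"
    and x: "norm x = 1"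
  shows "x \<bullet> T x \<le> 1 / 2 * (m + sqrt c)"
proof -
  have m0: "m \<ge> 0" using m[of x] x by (metis mult.right_neutral norm_ge_zero order_trans)
  have c0: "c \<ge> 0" using c[of x] x by (metis mult.right_neutral norm_ge_zero order_trans)
  obtain B where B: "finite B" "span B = UNIV" "pairwise orthogonal B" "\<And>u. u \<in> B \<Longrightarrow> norm u = 1"
    and TB: "pairwise (\<lambda>u v. orthogonal (T u) (T v)) B"
    using singular_value_basis_subspace[OF T subspace_UNIV] by blast
  have expand: "(\<Sum>u\<in>B. (u \<bullet> y) *\<^sub>R u) = y" for y
    using orthonormal_basis_expand[OF B(3,4) _ B(1), of y] B(2) by (simp add: inner_commute)
  have T_expand: "T y = (\<Sum>u\<in>B. (u \<bullet> y) *\<^sub>R T u)" for y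
    by (subst expand[of y, symmetric]) (simp add: linear_sum[OF T] linear_scale[OF T])
  \<comment> \<open>\<open>sgn (T u)\<close> is the left singular vector of \<open>u\<close>, or \<open>0\<close> if its singular value vanishes.\<close>
  define a where "a y = (\<Sum>u\<in>B. (norm (T u) * (u \<bullet> y)) *\<^sub>R u)" for y
  define W where "W y = (\<Sum>u\<in>B. (sgn (T u) \<bullet> y) *\<^sub>R u)" for y
  \<comment> \<open>\<open>W\<close> is the adjoint of the partial isometry in the polar
    decomposition of \<open>T\<close>, so \<open>b\<close> is the modulus of the adjoint of
    \<open>T\<close>. Factoring it through \<open>T\<close> lets the bounds \<open>m\<close> and
    \<open>c\<close> apply.\<close>
  define b where "b y = T (W y)" for y
  have b_eq: "b y = (\<Sum>u\<in>B. (sgn (T u) \<bullet> y) *\<^sub>R T u)" for y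
    by (simp add: b_def W_def linear_sum[OF T] linear_scale[OF T])
  have polar: "norm (T u) * (sgn (T u) \<bullet> y) = T u \<bullet> y" for u y
    by (cases "T u = 0") (simp_all add: sgn_div_norm)
  have lin_a: "linear a"
    by (rule linearI) (simp_all add: a_def inner_simps algebra_simps sum.distrib scaleR_sum_right)
  have lin_b: "linear b"
    by (rule linearI) (simp_all add: b_eq inner_simps algebra_simps sum.distrib scaleR_sum_right)
  have norm_a: "norm (a y) = norm (T y)" for y
  proof -
    have "(norm (T y))\<^sup>2 = (\<Sum>u\<in>B. (norm ((u \<bullet> y) *\<^sub>R T u))\<^sup>2)"
      unfolding T_expand[of y] using TB
      by (intro norm_sum_Pythagorean[OF B(1)]) (auto simp: pairwise_def orthogonal_def)
    also have "\<dots> = (norm (a y))\<^sup>2"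
      unfolding a_def by (subst norm_sum_orthonormal[OF B(1,3,4)]) (auto simp: power_mult_distrib mult.commute)
    finally show ?thesis by (simp add: power2_eq_iff_nonneg)
  qed
  have norm_W: "norm (W y) \<le> norm y" for y
  proof -
    have "(norm (W y))\<^sup>2 = (\<Sum>u\<in>B. (sgn (T u) \<bullet> y)\<^sup>2)"
      unfolding W_def by (rule norm_sum_orthonormal[OF B(1,3,4)])
    also have "\<dots> \<le> (norm y)\<^sup>2"
    proof (rule bessel_sum_bound[OF B(1)])
      show "pairwise (\<lambda>u v. orthogonal (sgn (T u)) (sgn (T v))) B"
        using TB by (simp add: pairwise_def orthogonal_def sgn_div_norm)
    qed (simp add: norm_sgn sgn_zero_iff)
    finally show ?thesis by (rule power2_le_imp_le) simp
  qed
  have norm_b: "norm (b y) \<le> m * norm y" for y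
    unfolding b_def using m[of "W y"] mult_left_mono[OF norm_W[of y] m0] by linarith
  \<comment> \<open>By \<open>norm_a\<close> the left side is the norm of
    \<open>T (T (W y))\<close>; here the bound on the square of \<open>T\<close> enters.\<close>
  have norm_ab: "norm (a (b y)) \<le> c * norm y" for y
    unfolding norm_a unfolding b_def using c[of "W y"] mult_left_mono[OF norm_W[of y] c0] by linarith
  define S where "S y = a y + b y" for y
  have lin_S: "linear S"
    unfolding S_def using lin_a lin_b by (rule linear_compose_add)
  have inner_a: "a y \<bullet> z = (\<Sum>u\<in>B. norm (T u) * (u \<bullet> y) * (u \<bullet> z))" for y z
    by (simp add: a_def inner_sum_left)
  have inner_b: "b y \<bullet> z = (\<Sum>u\<in>B. norm (T u) * (sgn (T u) \<bullet> y) * (sgn (T u) \<bullet> z))" for y z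
    by (simp add: b_eq inner_sum_left polar[symmetric] mult_ac)
  have sym: "S y \<bullet> z = S z \<bullet> y" for y z
    by (simp add: S_def inner_add_left inner_a inner_b mult_ac)
  have mixed: "2 * (x \<bullet> T x) \<le> S x \<bullet> x"
  proof -
    have "2 * (x \<bullet> T x) = (\<Sum>u\<in>B. norm (T u) * (2 * (u \<bullet> x) * (sgn (T u) \<bullet> x)))"
      by (subst T_expand) (simp add: inner_sum_right sum_distrib_left inner_commute[of x]
          polar[symmetric] mult_ac)
    \<comment> \<open>Mixed Schwarz reduces to \<open>2 * s * t \<le> s\<^sup>2 + t\<^sup>2\<close>
      in each term, weighted by the singular values.\<close>
    also have "\<dots> \<le> (\<Sum>u\<in>B. norm (T u) * ((u \<bullet> x)\<^sup>2 + (sgn (T u) \<bullet> x)\<^sup>2))"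
      by (intro sum_mono mult_left_mono sum_squares_bound) simp
    also have "\<dots> = S x \<bullet> x"
      by (simp add: S_def inner_add_left inner_a inner_b sum.distrib[symmetric]
          power2_eq_square algebra_simps)
    finally show ?thesis .
  qed
  have ne: "(UNIV :: 'a set) \<noteq> {0}" using x by (metis UNIV_I norm_zero singletonD zero_neq_one)
  obtain e where e: "norm e = 1"
    and max: "\<And>y. y \<in> UNIV \<Longrightarrow> S y \<bullet> y \<le> (S e \<bullet> e) * (norm y)\<^sup>2"
    and crit: "\<And>h. h \<in> UNIV \<Longrightarrow> S e \<bullet> h = (S e \<bullet> e) * (e \<bullet> h)"
    by (rule quadratic_form_maximizer[OF lin_S linear_ident sym subspace_UNIV ne]) (rule that)
  define \<mu> where "\<mu> = S e \<bullet> e"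
  have "S e = \<mu> *\<^sub>R e"
    unfolding \<mu>_def by (subst vector_eq_rdot[symmetric], unfold inner_scaleR_left) (intro allI crit UNIV_I)
  then have ae: "a e = \<mu> *\<^sub>R e - b e" and be: "b e = \<mu> *\<^sub>R e - a e"
    by (simp_all add: S_def algebra_simps)
  have "\<mu> \<le> m + sqrt c"
  proof (cases "\<mu> \<le> m")
    case True
    then show ?thesis using c0 by (simp add: add_increasing2)
  next
    case False
    have lower: "(\<mu> - m) * norm y \<le> norm (\<mu> *\<^sub>R y - z)" if "norm z \<le> m * norm y" for y z :: 'a
      using norm_triangle_ineq2[of "\<mu> *\<^sub>R y" z] that False m0 by (simp add: algebra_simps)
    \<comment> \<open>\<open>lower\<close> is used twice: first on
      \<open>a e = \<mu> *\<^sub>R e - b e\<close>, then on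
      \<open>a (b e) = \<mu> *\<^sub>R a e - a (a e)\<close>.\<close>
    have "(\<mu> - m) * ((\<mu> - m) * norm e) \<le> (\<mu> - m) * norm (a e)"
      using False lower[OF norm_b, of e] by (intro mult_left_mono) (simp_all add: ae)
    also have "\<dots> \<le> norm (\<mu> *\<^sub>R a e - a (a e))"
      by (intro lower) (simp add: norm_a[of "a e"] m)
    also have "\<mu> *\<^sub>R a e - a (a e) = a (b e)"
      by (subst be) (simp add: linear_diff[OF lin_a] linear_scale[OF lin_a])
    also have "norm \<dots> \<le> c * norm e" by (rule norm_ab)
    finally have "(\<mu> - m)\<^sup>2 \<le> c" using e by (simp add: power2_eq_square)
    then have "\<mu> - m \<le> sqrt c" by (rule real_le_rsqrt)
    then show ?thesis by simp
  qed
  moreover have "S x \<bullet> x \<le> \<mu>" using max[OF UNIV_I, of x] x by (simp add: \<mu>_def)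
  ultimately show ?thesis using mixed by simp
qed

section \<open>Reduction from quaternionic to real operators\<close>

text \<open>Makes \<open>quat ^ 'n\<close> a real Euclidean space, as \<open>kittaneh_real\<close>
  requires.\<close>

instantiation quat :: euclidean_space
begin

definition Basis_quat :: "quat set" where
  "Basis = {Quat 1 0 0 0, Quat 0 1 0 0, Quat 0 0 1 0, Quat 0 0 0 1}"

instance
proof
  show "(\<forall>u\<in>Basis. x \<bullet> u = 0) \<longleftrightarrow> x = 0" for x :: quat
    by (simp add: Basis_quat_def inner_quat_def quat_eq_iff[of x 0])
qed (auto simp: Basis_quat_def inner_quat_def)

end

lemma linear_matrix_vector_mult_times:
  fixes A :: "quat ^ 'n ^ 'n::finite"
  shows "linear (\<lambda>Y. \<chi> i. (A *v Y) $ i * u)"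
proof (rule linearI)
  show "(\<chi> i. (A *v (X + Y)) $ i * u) = (\<chi> i. (A *v X) $ i * u) + (\<chi> i. (A *v Y) $ i * u)" for X Y
    by (simp add: vec_eq_iff matrix_vector_mult_def sum.distrib distrib_left distrib_right)
  show "(\<chi> i. (A *v (r *\<^sub>R Y)) $ i * u) = r *\<^sub>R (\<chi> i. (A *v Y) $ i * u)" for r Y
    by (simp add: vec_eq_iff matrix_vector_mult_def flip: scaleR_sum_right)
qed

lemma norm_times_unit:
  fixes Y :: "quat ^ 'n::finite"
  assumes "norm u = 1"
  shows "norm (\<chi> i. Y $ i * u) = norm Y"
  using assms by (simp add: norm_vec_def norm_mult)

text \<open>Matrix entries act from the left, so associativity lets right scalars pass
  through.\<close>

lemma matrix_vector_mult_times:
  fixes A :: "quat ^ 'n ^ 'n::finite"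
  shows "A *v (\<chi> i. Y $ i * u) = (\<chi> i. (A *v Y) $ i * u)"
  by (simp add: vec_eq_iff matrix_vector_mult_def sum_distrib_right mult.assoc)

lemma norm_matrix_vector_le_opnorm:
  fixes A :: "quat ^ 'n ^ 'n::finite"
  shows "norm (A *v Y) \<le> opnorm A * norm Y"
proof (cases "Y = 0")
  case True
  moreover have "A *v 0 = 0" by (simp add: vec_eq_iff matrix_vector_mult_def)
  ultimately show ?thesis by simp
next
  case False
  have lin: "A *v (r *\<^sub>R Z) = r *\<^sub>R (A *v Z)" for r Z
    by (simp add: vec_eq_iff matrix_vector_mult_def scaleR_sum_right)
  have "norm (A *v sgn Y) \<le> opnorm A"
    unfolding opnorm_def
    by (rule cSUP_upper[OF _ bdd_above_opnorm]) (simp add: norm_sgn False)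
  then show ?thesis
    using False by (simp add: sgn_div_norm lin field_simps)
qed

lemma qRe_hinner:
  fixes X Y :: "quat ^ 'n::finite"
  shows "qRe (hinner X Y) = X \<bullet> Y"
proof -
  have "qRe (sum f I) = (\<Sum>i\<in>I. qRe (f i))" for f :: "'n \<Rightarrow> quat" and I
    by (induction I rule: infinite_finite_induct) auto
  then show ?thesis
    by (simp add: hinner_def inner_vec_def inner_quat_def)
qed

lemma exists_unit_times_eq_norm:
  fixes q :: quat
  obtains u where "norm u = 1" "q * u = of_real (norm q)"
proof (cases "q = 0")
  case True
  then show ?thesis using that[of 1] by simp
next
  case False
  then show ?thesis
    \<comment> \<open>The factor stands on the right of \<open>q\<close> so that it can be absorbed
      into the second argument of \<open>hinner\<close>.\<close>
    using that[of "inverse q * of_real (norm q)"]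
    by (simp add: norm_mult norm_inverse mult.assoc[symmetric])
qed

theorem theorem3p7:
  fixes A :: "quat ^ 'n ^ 'n::finite"
  shows "w_H A \<le> 1 / 2 * (opnorm A + sqrt (opnorm (A ** A)))"
  unfolding w_H_def
proof (rule cSUP_least[OF W_H_nonempty])
  fix q assume "q \<in> W_H A"
  then obtain X where X: "norm X = 1" and q: "q = hinner X (A *v X)"
    by (auto simp: W_H_def)
  obtain u where u: "norm u = 1" "q * u = of_real (norm q)"
    by (rule exists_unit_times_eq_norm)
  define T where "T Y = (\<chi> i. (A *v Y) $ i * u)" for Y
  have "norm q = qRe (q * u)"
    by (simp add: u of_real_def)
  also have "q * u = hinner X (T X)"
    by (simp add: q hinner_def T_def sum_distrib_right mult.assoc)
  also have "qRe \<dots> = X \<bullet> T X"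
    by (rule qRe_hinner)
  also have "\<dots> \<le> 1 / 2 * (opnorm A + sqrt (opnorm (A ** A)))"
  proof (rule kittaneh_real)
    show "linear T"
      unfolding T_def by (rule linear_matrix_vector_mult_times)
    show "norm (T Y) \<le> opnorm A * norm Y" for Y
      by (simp add: T_def norm_times_unit u norm_matrix_vector_le_opnorm)
    show "norm (T (T Y)) \<le> opnorm (A ** A) * norm Y" for Y
      \<comment> \<open>Pulling the inner \<open>u\<close> through \<open>A\<close> turns
        \<open>T (T Y)\<close> into \<open>(A ** A) *v Y\<close> multiplied twice on the right by
        \<open>u\<close>, which preserves the norm.\<close>
      using norm_matrix_vector_le_opnorm[of "A ** A" Y]
      by (simp only: T_def norm_times_unit u(1) matrix_vector_mult_times matrix_vector_mul_assoc)
  qed (rule X)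
  finally show "norm q \<le> 1 / 2 * (opnorm A + sqrt (opnorm (A ** A)))" .
qed

end
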